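(* Let $S$ be a multiplicatively closed subset of a ring $R$, $I$ an ideal of $R$, and $K\subseteq N$ submodules of an $R$-module $M$ with $IM\subseteq N$. Let $I\ltimes N$ be a weakly $S\ltimes K$-prime ideal of $R\ltimes M$. Then: (1) $I$ is a weakly $S$-prime ideal of $R$, and $N$ is a weakly $S$-prime submodule of $M$ whenever $(N:_{R}M)\cap S=\emptyset$. (2) There exists $s\in S$ such that: for all $a,b\in R$, if $ab=0$, $sa\notin I$ and $sb\notin I$, then $a,b\in ann(N)$; and for all $c\in R$, $m\in M$, if $cm=0$, $sc\notin(N:_{R}M)$ and $sm\notin N$, then $c\in ann(I)$ and $m\in(0:_{M}I)$. (3) If $I\ltimes N$ is not $S\ltimes K$-prime, then $(s,k)(I\ltimes N)=(sI\ltimes0)\oplus(0\ltimes (sN+Ik))$ for some $(s,k)\in S\ltimes K$. (4) If $I\ltimes N$ is $S\ltimes K$-prime, then $sM\subseteq N$ for some $s\in S$.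
   Context: Rings are commutative with non-zero identity and modules are unital. A non-empty subset $S$ of $R$ is multiplicatively closed if it is closed under multiplication. $(N:_{R}M)=\{r\in R: rM\subseteq N\}$, $ann(N)=\{r\in R: rN=0\}$, $ann(I)=\{r\in R: rI=0\}$, $(0:_{M}I)=\{m\in M: Im=0\}$. The idealization $R\ltimes M$ is the commutative ring $R\oplus M$ with coordinatewise addition and multiplication $(r_{1},m_{1})(r_{2},m_{2})=(r_{1}r_{2},r_{1}m_{2}+r_{2}m_{1})$. For an ideal $I$ of $R$ and a submodule $N$ of $M$, $I\ltimes N=\{(a,n):a\in I,n\in N\}$, which is an ideal of $R\ltimes M$ if and only if $IM\subseteq N$. For a submodule $K$ of $M$, $S\ltimes K=\{(s,k):s\in S,k\in K\}$ is a multiplicatively closed subset of $R\ltimes M$. For a multiplicatively closed subset $T$ of a ring $A$, an ideal $P$ of $A$ with $P\cap T=\emptyset$ is $T$-prime (respectively weakly $T$-prime) if there exists $t\in T$ such that for all $a,b\in A$ with $ab\in P$ (respectively $0\neq ab\in P$), either $ta\in P$ or $tb\in P$. A submodule $N$ of $M$ with $(N:_{R}M)\cap S=\emptyset$ is weakly $S$-prime if there exists a fixed $s\in S$ such that for all $a\in R$, $m\in M$ with $0\neq am\in N$, either $sa\in(N:_{R}M)$ or $sm\in N$. *)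

theory Defs
  imports "HOL-Algebra.Module" "HOL-Algebra.Ideal" "HOL-Algebra.Generated_Groups"
begin

text \<open>Only nonempty and closed under multiplication: \<open>\<one>\<close> need not belong to \<open>S\<close>.\<close>

definition mult_closed :: "('a, 'b) ring_scheme \<Rightarrow> 'a set \<Rightarrow> bool"
  where "mult_closed R S \<longleftrightarrow>
    S \<subseteq> carrier R \<and> S \<noteq> {} \<and> (\<forall>a\<in>S. \<forall>b\<in>S. a \<otimes>\<^bsub>R\<^esub> b \<in> S)"

definition idealization ::
  "('a, 'c) ring_scheme \<Rightarrow> ('a, 'm, 'd) module_scheme \<Rightarrow> ('a \<times> 'm) ring"
  where "idealization R M =
    \<lparr> carrier = carrier R \<times> carrier M,
      mult = (\<lambda>(r1, m1) (r2, m2). (r1 \<otimes>\<^bsub>R\<^esub> r2, r1 \<odot>\<^bsub>M\<^esub> m2 \<oplus>\<^bsub>M\<^esub> r2 \<odot>\<^bsub>M\<^esub> m1)),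
      one = (\<one>\<^bsub>R\<^esub>, \<zero>\<^bsub>M\<^esub>),
      zero = (\<zero>\<^bsub>R\<^esub>, \<zero>\<^bsub>M\<^esub>),
      add = (\<lambda>(r1, m1) (r2, m2). (r1 \<oplus>\<^bsub>R\<^esub> r2, m1 \<oplus>\<^bsub>M\<^esub> m2)) \<rparr>"

text \<open>
  For subsets \<open>A\<close> of \<open>R\<close> and \<open>B\<close> of \<open>M\<close>, the subset \<open>{(a, b). a \<in> A \<and> b \<in> B}\<close> of the
  idealization is the library's \<open>A \<times> B\<close>.
\<close>

definition colon :: "('a, 'c) ring_scheme \<Rightarrow> ('a, 'm, 'd) module_scheme \<Rightarrow> 'm set \<Rightarrow> 'a set"
  where "colon R M N = {r \<in> carrier R. \<forall>m\<in>carrier M. r \<odot>\<^bsub>M\<^esub> m \<in> N}"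

definition ann_module :: "('a, 'c) ring_scheme \<Rightarrow> ('a, 'm, 'd) module_scheme \<Rightarrow> 'm set \<Rightarrow> 'a set"
  where "ann_module R M N = {r \<in> carrier R. \<forall>n\<in>N. r \<odot>\<^bsub>M\<^esub> n = \<zero>\<^bsub>M\<^esub>}"

definition ann_ideal :: "('a, 'c) ring_scheme \<Rightarrow> 'a set \<Rightarrow> 'a set"
  where "ann_ideal R I = {r \<in> carrier R. \<forall>i\<in>I. r \<otimes>\<^bsub>R\<^esub> i = \<zero>\<^bsub>R\<^esub>}"

definition zero_colon :: "('a, 'm, 'd) module_scheme \<Rightarrow> 'a set \<Rightarrow> 'm set"
  where "zero_colon M I = {m \<in> carrier M. \<forall>i\<in>I. i \<odot>\<^bsub>M\<^esub> m = \<zero>\<^bsub>M\<^esub>}"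

text \<open>The product \<open>I M\<close>: the additive subgroup of \<open>M\<close> generated by the products \<open>i m\<close>.\<close>

definition ideal_smult :: "'a set \<Rightarrow> ('a, 'm, 'd) module_scheme \<Rightarrow> 'm set"
  where "ideal_smult I M = generate (add_monoid M) {i \<odot>\<^bsub>M\<^esub> m | i m. i \<in> I \<and> m \<in> carrier M}"

definition S_prime_ideal :: "'a set \<Rightarrow> 'a set \<Rightarrow> ('a, 'c) ring_scheme \<Rightarrow> bool"
  where "S_prime_ideal T P A \<longleftrightarrow> ideal P A \<and> P \<inter> T = {} \<and>
    (\<exists>t\<in>T. \<forall>a\<in>carrier A. \<forall>b\<in>carrier A.
      a \<otimes>\<^bsub>A\<^esub> b \<in> P \<longrightarrow> t \<otimes>\<^bsub>A\<^esub> a \<in> P \<or> t \<otimes>\<^bsub>A\<^esub> b \<in> P)"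

definition weakly_S_prime_ideal :: "'a set \<Rightarrow> 'a set \<Rightarrow> ('a, 'c) ring_scheme \<Rightarrow> bool"
  where "weakly_S_prime_ideal T P A \<longleftrightarrow> ideal P A \<and> P \<inter> T = {} \<and>
    (\<exists>t\<in>T. \<forall>a\<in>carrier A. \<forall>b\<in>carrier A.
      a \<otimes>\<^bsub>A\<^esub> b \<noteq> \<zero>\<^bsub>A\<^esub> \<and> a \<otimes>\<^bsub>A\<^esub> b \<in> P \<longrightarrow> t \<otimes>\<^bsub>A\<^esub> a \<in> P \<or> t \<otimes>\<^bsub>A\<^esub> b \<in> P)"

definition weakly_S_prime_submodule ::
  "'a set \<Rightarrow> 'm set \<Rightarrow> ('a, 'c) ring_scheme \<Rightarrow> ('a, 'm, 'd) module_scheme \<Rightarrow> bool"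
  where "weakly_S_prime_submodule S N R M \<longleftrightarrow> submodule N R M \<and> colon R M N \<inter> S = {} \<and>
    (\<exists>s\<in>S. \<forall>a\<in>carrier R. \<forall>m\<in>carrier M.
      a \<odot>\<^bsub>M\<^esub> m \<noteq> \<zero>\<^bsub>M\<^esub> \<and> a \<odot>\<^bsub>M\<^esub> m \<in> N \<longrightarrow>
        s \<otimes>\<^bsub>R\<^esub> a \<in> colon R M N \<or> s \<odot>\<^bsub>M\<^esub> m \<in> N)"

text \<open>\<open>J = U \<oplus> V\<close> as an internal direct sum of ideals of \<open>A\<close>.\<close>

definition ideal_direct_sum :: "('a, 'c) ring_scheme \<Rightarrow> 'a set \<Rightarrow> 'a set \<Rightarrow> 'a set \<Rightarrow> bool"
  where "ideal_direct_sum A J U V \<longleftrightarrow>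
    ideal U A \<and> ideal V A \<and> U \<inter> V = {\<zero>\<^bsub>A\<^esub>} \<and> J = U <+>\<^bsub>A\<^esub> V"

lemma idealization_simps [simp]:
  "carrier (idealization R M) = carrier R \<times> carrier M"
  "(r1, m1) \<otimes>\<^bsub>idealization R M\<^esub> (r2, m2) =
    (r1 \<otimes>\<^bsub>R\<^esub> r2, r1 \<odot>\<^bsub>M\<^esub> m2 \<oplus>\<^bsub>M\<^esub> r2 \<odot>\<^bsub>M\<^esub> m1)"
  "\<one>\<^bsub>idealization R M\<^esub> = (\<one>\<^bsub>R\<^esub>, \<zero>\<^bsub>M\<^esub>)"
  "\<zero>\<^bsub>idealization R M\<^esub> = (\<zero>\<^bsub>R\<^esub>, \<zero>\<^bsub>M\<^esub>)"
  "(r1, m1) \<oplus>\<^bsub>idealization R M\<^esub> (r2, m2) = (r1 \<oplus>\<^bsub>R\<^esub> r2, m1 \<oplus>\<^bsub>M\<^esub> m2)"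
  by (simp_all add: idealization_def)

lemma (in module) idealization_cring: "cring (idealization R M)"
proof (intro cringI abelian_groupI comm_monoidI)
  fix x assume "x \<in> carrier (idealization R M)"
  then obtain r m where "x = (r, m)" "r \<in> carrier R" "m \<in> carrier M" by auto
  then show "\<exists>y\<in>carrier (idealization R M). y \<oplus>\<^bsub>idealization R M\<^esub> x = \<zero>\<^bsub>idealization R M\<^esub>"
    by (intro bexI[of _ "(\<ominus> r, \<ominus>\<^bsub>M\<^esub> m)"]) (auto simp: R.l_neg M.l_neg)
qed (auto simp: R.a_ac M.a_ac R.m_ac smult_l_distr smult_r_distr
       R.l_distr R.r_distr smult_assoc1[symmetric])

lemma (in module) idealization_mult_closed:
  assumes "mult_closed R S" and "submodule K R M"
  shows "mult_closed (idealization R M) (S \<times> K)"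
  using assms submoduleE[OF assms(2)] by (auto simp: mult_closed_def subset_iff)

end

theory Submission
  imports Defs
begin

text \<open>
  Write \<open>A\<close> for the idealization, \<open>P = I \<times> N\<close>, and fix a witness \<open>t = (s, k)\<close> of weak primeness.
  Since \<open>k \<in> N\<close> and \<open>N\<close> absorbs scalars, \<open>t (a, m) \<in> P\<close> just says \<open>s a \<in> I\<close> and \<open>s m \<in> N\<close>, so \<open>k\<close>
  becomes invisible. Weak primeness is used throughout in its contrapositive form: if \<open>x y \<in> P\<close> while
  \<open>t x \<notin> P\<close> and \<open>t y \<notin> P\<close>, then \<open>x y = 0\<close>. All claims but the last
  come from feeding this principle well-chosen pairs \<open>x, y\<close>:

  \<^item> \<open>(a, 0) (b, 0)\<close> and \<open>(c, 0) (0, m)\<close> show that \<open>I\<close> and \<open>N\<close> are weakly prime with witness \<open>s\<close>.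
  \<^item> \<open>(a, n) (b, 0) = (0, b n)\<close> when \<open>a b = 0\<close>, \<open>(c, 0) (i, m) = (c i, 0)\<close> when \<open>c m = 0\<close>, and
    \<open>(c + i, 0) (0, m) = (0, i m)\<close> when \<open>c m = 0\<close> give the annihilation statements. Here
    \<open>n \<in> N\<close> and \<open>i \<in> I\<close> are perturbations that change neither membership in \<open>P\<close> nor the
    failure of \<open>t x \<in> P\<close>.
  \<^item> If \<open>P\<close> is not prime, the same perturbation idea in \<open>A\<close> gives \<open>P P = 0\<close>, that is, \<open>I I = 0\<close>
    and \<open>I N = 0\<close>. In addition \<open>(0, m) (i, m) = (0, i m)\<close> shows \<open>i m = 0\<close> whenever
    \<open>s m \<notin> N\<close>, while \<open>i (s m) \<in> I N = 0\<close> when \<open>s m \<in> N\<close>; so \<open>(s I) M = 0\<close>.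
    Now \<open>I k = 0\<close> because \<open>k \<in> N\<close>, so \<open>t P = s I \<times> s N\<close>; and \<open>(s I) M = 0\<close> is exactly what makes \<open>s I \<times> 0\<close> an ideal, so that
    \<open>s I \<times> s N\<close> splits.
  \<^item> If \<open>P\<close> is prime with witness \<open>(s', k')\<close>, then \<open>(0, m) (0, m) = 0 \<in> P\<close> forces \<open>s' m \<in> N\<close>.
\<close>

section \<open>Ideals and submodules from closure properties\<close>

lemma (in cring) idealI_closed:
  assumes "J \<subseteq> carrier R" and "J \<noteq> {}"
    and "\<And>x y. x \<in> J \<Longrightarrow> y \<in> J \<Longrightarrow> x \<oplus> y \<in> J"
    and "\<And>r x. r \<in> carrier R \<Longrightarrow> x \<in> J \<Longrightarrow> r \<otimes> x \<in> J"
  shows "ideal J R"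
proof (rule idealI)
  show "subgroup J (add_monoid R)"
  proof (rule add.subgroupI)
    fix x assume x: "x \<in> J"
    have "\<ominus> \<one> \<otimes> x = \<ominus> x"
      using x assms(1) by (simp add: l_minus subset_iff)
    then show "\<ominus> x \<in> J"
      using assms(4)[OF _ x, of "\<ominus> \<one>"] by simp
  qed (use assms in auto)
  fix a x assume "a \<in> J" "x \<in> carrier R"
  then show "a \<otimes> x \<in> J" using assms(1,4) m_comm by (metis subsetD)
qed (use assms ring_axioms in auto)

lemma (in module) submoduleI_closed:
  assumes "H \<subseteq> carrier M" and "H \<noteq> {}"
    and "\<And>x y. x \<in> H \<Longrightarrow> y \<in> H \<Longrightarrow> x \<oplus>\<^bsub>M\<^esub> y \<in> H"
    and "\<And>r x. r \<in> carrier R \<Longrightarrow> x \<in> H \<Longrightarrow> r \<odot>\<^bsub>M\<^esub> x \<in> H"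
  shows "submodule H R M"
proof (rule submoduleI)
  obtain h where h: "h \<in> H" using assms(2) by auto
  have "\<zero> \<odot>\<^bsub>M\<^esub> h = \<zero>\<^bsub>M\<^esub>"
    using h assms(1) by auto
  then show "\<zero>\<^bsub>M\<^esub> \<in> H"
    using assms(4)[OF _ h, of \<zero>] by simp
  fix x assume x: "x \<in> H"
  have "\<ominus> \<one> \<odot>\<^bsub>M\<^esub> x = \<ominus>\<^bsub>M\<^esub> x"
    using x assms(1) by (simp add: smult_l_minus subset_iff)
  then show "\<ominus>\<^bsub>M\<^esub> x \<in> H"
    using assms(4)[OF _ x, of "\<ominus> \<one>"] by simp
qed (use assms in auto)

lemma (in module) submodule_zero_mem:
  assumes "submodule N R M"
  shows "\<zero>\<^bsub>M\<^esub> \<in> N"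
  using subgroup.one_closed[OF submodule.axioms(1)[OF assms]] by simp

lemma (in module) submodule_add_cancel:
  assumes N: "submodule N R M" and n: "n \<in> N" and m: "m \<in> carrier M"
  shows "m \<oplus>\<^bsub>M\<^esub> n \<in> N \<longleftrightarrow> m \<in> N"
proof
  assume "m \<oplus>\<^bsub>M\<^esub> n \<in> N"
  then have "(m \<oplus>\<^bsub>M\<^esub> n) \<oplus>\<^bsub>M\<^esub> \<ominus>\<^bsub>M\<^esub> n \<in> N"
    using submoduleE(3,5)[OF N] n by blast
  moreover have "n \<in> carrier M" using submoduleE(1)[OF N] n by auto
  ultimately show "m \<in> N" using m by (simp add: M.a_assoc M.r_neg)
qed (use submoduleE(5)[OF N] n in blast)

lemma ideal_zero_mem:
  assumes "ideal J R"
  shows "\<zero>\<^bsub>R\<^esub> \<in> J"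
  by (rule additive_subgroup.zero_closed[OF ideal.axioms(1)[OF assms]])

lemma ideal_add_mem:
  assumes "ideal J R" and "x \<in> J" and "y \<in> J"
  shows "x \<oplus>\<^bsub>R\<^esub> y \<in> J"
  using assms by (rule additive_subgroup.a_closed[OF ideal.axioms(1)])

lemma (in cring) ideal_add_cancel:
  assumes J: "ideal J R" and j: "j \<in> J" and a: "a \<in> carrier R"
  shows "a \<oplus> j \<in> J \<longleftrightarrow> a \<in> J"
proof
  interpret J: ideal J R by (rule J)
  assume "a \<oplus> j \<in> J"
  then have "(a \<oplus> j) \<oplus> \<ominus> j \<in> J" using j by simp
  moreover have "j \<in> carrier R" using j by (rule J.a_Hcarr)
  ultimately show "a \<in> J" using a by (simp add: a_assoc r_neg)
next
  assume "a \<in> J"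
  then show "a \<oplus> j \<in> J"
    using j ideal_add_mem[OF J] by blast
qed

lemma (in cring) ideal_image_mult:
  assumes J: "ideal J R" and s: "s \<in> carrier R"
  shows "ideal ((\<lambda>i. s \<otimes> i) ` J) R"
proof -
  interpret J: ideal J R by (rule J)
  show ?thesis
  proof (rule idealI_closed)
    show "(\<lambda>i. s \<otimes> i) ` J \<noteq> {}" using ideal_zero_mem[OF J] by blast
    fix x y assume "x \<in> (\<lambda>i. s \<otimes> i) ` J" "y \<in> (\<lambda>i. s \<otimes> i) ` J"
    then obtain i j where ij: "i \<in> J" "j \<in> J" "x = s \<otimes> i" "y = s \<otimes> j" by auto
    then have "x \<oplus> y = s \<otimes> (i \<oplus> j)" using s J.a_Hcarr by (simp add: r_distr)
    then show "x \<oplus> y \<in> (\<lambda>i. s \<otimes> i) ` J" using ij ideal_add_mem[OF J] by blast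
  next
    fix r x assume r: "r \<in> carrier R" and "x \<in> (\<lambda>i. s \<otimes> i) ` J"
    then obtain i where i: "i \<in> J" "x = s \<otimes> i" by auto
    then have "r \<otimes> x = s \<otimes> (r \<otimes> i)" using r s J.a_Hcarr by (simp add: m_lcomm)
    then show "r \<otimes> x \<in> (\<lambda>i. s \<otimes> i) ` J" using i r J.I_l_closed by blast
  qed (use s J.a_Hcarr in auto)
qed

lemma (in module) submodule_image_smult:
  assumes N: "submodule N R M" and s: "s \<in> carrier R"
  shows "submodule ((\<lambda>n. s \<odot>\<^bsub>M\<^esub> n) ` N) R M"
proof (rule submoduleI_closed)
  note NM = subsetD[OF submoduleE(1)[OF N]]
  show "(\<lambda>n. s \<odot>\<^bsub>M\<^esub> n) ` N \<subseteq> carrier M" using s NM by auto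
  show "(\<lambda>n. s \<odot>\<^bsub>M\<^esub> n) ` N \<noteq> {}" using submoduleE(2)[OF N] by auto
  fix x y assume "x \<in> (\<lambda>n. s \<odot>\<^bsub>M\<^esub> n) ` N" "y \<in> (\<lambda>n. s \<odot>\<^bsub>M\<^esub> n) ` N"
  then obtain n p where np: "n \<in> N" "p \<in> N" "x = s \<odot>\<^bsub>M\<^esub> n" "y = s \<odot>\<^bsub>M\<^esub> p" by auto
  then have "x \<oplus>\<^bsub>M\<^esub> y = s \<odot>\<^bsub>M\<^esub> (n \<oplus>\<^bsub>M\<^esub> p)" using s NM by (simp add: smult_r_distr)
  then show "x \<oplus>\<^bsub>M\<^esub> y \<in> (\<lambda>n. s \<odot>\<^bsub>M\<^esub> n) ` N" using np submoduleE(5)[OF N] by blast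
next
  note NM = subsetD[OF submoduleE(1)[OF N]]
  fix r x assume r: "r \<in> carrier R" and "x \<in> (\<lambda>n. s \<odot>\<^bsub>M\<^esub> n) ` N"
  then obtain n where n: "n \<in> N" "x = s \<odot>\<^bsub>M\<^esub> n" by auto
  then have "r \<odot>\<^bsub>M\<^esub> x = s \<odot>\<^bsub>M\<^esub> (r \<odot>\<^bsub>M\<^esub> n)"
    using r s NM by (metis R.m_comm smult_assoc1)
  then show "r \<odot>\<^bsub>M\<^esub> x \<in> (\<lambda>n. s \<odot>\<^bsub>M\<^esub> n) ` N" using n r submoduleE(4)[OF N] by blast
qed

section \<open>Weakly prime ideals that are not prime\<close>

text \<open>
  A failure of primeness is a pair \<open>x, y\<close> with \<open>x y \<in> P\<close> and \<open>t x, t y\<close> outside \<open>P\<close>, so \<open>x y = 0\<close>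
  by weak primeness. Perturbing one factor by \<open>p \<in> P\<close> leaves
  \<open>t x, t y\<close> outside \<open>P\<close> and the product inside \<open>P\<close>, so the perturbed product is still zero; this gives
  \<open>x p = 0\<close> and \<open>p y = 0\<close>, and then \<open>(x + p) (y + q) = p q\<close> vanishes for the same reason.
\<close>

lemma (in cring) weakly_prime_not_prime_square_zero:
  assumes P: "ideal P R" and t: "t \<in> carrier R"
    and weak: "\<And>x y. \<lbrakk>x \<in> carrier R; y \<in> carrier R; x \<otimes> y \<in> P; t \<otimes> x \<notin> P; t \<otimes> y \<notin> P\<rbrakk>
      \<Longrightarrow> x \<otimes> y = \<zero>"
    and x: "x \<in> carrier R" and y: "y \<in> carrier R" and xy: "x \<otimes> y \<in> P"
    and tx: "t \<otimes> x \<notin> P" and ty: "t \<otimes> y \<notin> P"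
    and p: "p \<in> P" and q: "q \<in> P"
  shows "p \<otimes> q = \<zero>"
proof -
  interpret P: ideal P R by (rule P)
  have xy0: "x \<otimes> y = \<zero>" using weak x y xy tx ty by blast
  have pc: "p \<in> carrier R" and qc: "q \<in> carrier R" using p q P.a_Hcarr by auto
  have perturb: "t \<otimes> (z \<oplus> r) \<notin> P" if "z \<in> carrier R" "r \<in> P" "t \<otimes> z \<notin> P" for z r
  proof -
    have "t \<otimes> (z \<oplus> r) = t \<otimes> z \<oplus> t \<otimes> r"
      using that t P.a_Hcarr by (simp add: r_distr)
    then show ?thesis
      using that t ideal_add_cancel[OF P P.I_l_closed[OF that(2) t]] by simp
  qed
  have xq: "x \<otimes> q = \<zero>"
  proof -
    have eq: "x \<otimes> (y \<oplus> q) = x \<otimes> q" using x y qc xy0 by (simp add: r_distr)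
    moreover have "x \<otimes> q \<in> P" using x q by (rule P.I_l_closed[rotated])
    ultimately show ?thesis
      using weak[of x "y \<oplus> q"] perturb[OF y q ty] x y qc tx by simp
  qed
  have py: "p \<otimes> y = \<zero>"
  proof -
    have eq: "(x \<oplus> p) \<otimes> y = p \<otimes> y" using x y pc xy0 by (simp add: l_distr)
    moreover have "p \<otimes> y \<in> P" using p y by (rule P.I_r_closed)
    ultimately show ?thesis
      using weak[of "x \<oplus> p" y] perturb[OF x p tx] x y pc ty by simp
  qed
  have "(x \<oplus> p) \<otimes> (y \<oplus> q) = p \<otimes> q"
    using x y pc qc xy0 xq py by (simp add: l_distr r_distr)
  moreover have "p \<otimes> q \<in> P" using p qc by (rule P.I_r_closed)
  ultimately show ?thesis
    using weak[of "x \<oplus> p" "y \<oplus> q"] perturb[OF x p tx] perturb[OF y q ty] x y pc qc by simp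
qed

section \<open>Product ideals of the idealization\<close>

lemma (in module) ideal_Times_idealization:
  assumes J: "ideal J R" and N: "submodule N R M"
    and JM: "\<And>j m. j \<in> J \<Longrightarrow> m \<in> carrier M \<Longrightarrow> j \<odot>\<^bsub>M\<^esub> m \<in> N"
  shows "ideal (J \<times> N) (idealization R M)"
proof -
  interpret J: ideal J R by (rule J)
  note NM = subsetD[OF submoduleE(1)[OF N]]
  show ?thesis
  proof (rule cring.idealI_closed[OF idealization_cring])
    show "J \<times> N \<noteq> {}" using ideal_zero_mem[OF J] submoduleE(2)[OF N] by blast
    show "J \<times> N \<subseteq> carrier (idealization R M)" using J.a_Hcarr NM by auto
  qed (use ideal_add_mem[OF J] J.I_l_closed submoduleE(4,5)[OF N] JM in auto)
qed

text \<open>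
  The summand \<open>J \<times> 0\<close> is closed under multiplication by \<open>(0, m)\<close> only because \<open>J M = 0\<close>.
\<close>

lemma (in module) ideal_direct_sum_Times:
  assumes J: "ideal J R" and N: "submodule N R M"
    and JM: "\<And>j m. j \<in> J \<Longrightarrow> m \<in> carrier M \<Longrightarrow> j \<odot>\<^bsub>M\<^esub> m = \<zero>\<^bsub>M\<^esub>"
  shows "ideal_direct_sum (idealization R M) (J \<times> N) (J \<times> {\<zero>\<^bsub>M\<^esub>}) ({\<zero>} \<times> N)"
proof -
  interpret J: ideal J R by (rule J)
  note NM = subsetD[OF submoduleE(1)[OF N]]
  note N0 = submodule_zero_mem[OF N]
  have zero: "submodule {\<zero>\<^bsub>M\<^esub>} R M" by (rule submoduleI_closed) auto
  have U: "ideal (J \<times> {\<zero>\<^bsub>M\<^esub>}) (idealization R M)"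
    by (rule ideal_Times_idealization[OF J zero]) (simp add: JM)
  have V: "ideal ({\<zero>} \<times> N) (idealization R M)"
    by (rule ideal_Times_idealization[OF R.zeroideal N]) (simp add: N0)
  have "J \<times> N = (J \<times> {\<zero>\<^bsub>M\<^esub>}) <+>\<^bsub>idealization R M\<^esub> ({\<zero>} \<times> N)"
  proof (intro equalityI subrelI)
    fix j n assume "(j, n) \<in> J \<times> N"
    then have jn: "j \<in> J" "n \<in> N" by auto
    have "(j, n) = (j, \<zero>\<^bsub>M\<^esub>) \<oplus>\<^bsub>idealization R M\<^esub> (\<zero>, n)"
      using J.a_Hcarr[OF jn(1)] NM[OF jn(2)] by simp
    then show "(j, n) \<in> (J \<times> {\<zero>\<^bsub>M\<^esub>}) <+>\<^bsub>idealization R M\<^esub> ({\<zero>} \<times> N)"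
      unfolding set_add_def' using jn by blast
  next
    fix j n assume "(j, n) \<in> (J \<times> {\<zero>\<^bsub>M\<^esub>}) <+>\<^bsub>idealization R M\<^esub> ({\<zero>} \<times> N)"
    then obtain i p where "i \<in> J" "p \<in> N"
      "(j, n) = (i, \<zero>\<^bsub>M\<^esub>) \<oplus>\<^bsub>idealization R M\<^esub> (\<zero>, p)"
      unfolding set_add_def' by blast
    then show "(j, n) \<in> J \<times> N" using J.a_Hcarr NM by simp
  qed
  moreover have "(J \<times> {\<zero>\<^bsub>M\<^esub>}) \<inter> ({\<zero>} \<times> N) = {\<zero>\<^bsub>idealization R M\<^esub>}"
    using N0 by auto
  ultimately show ?thesis
    unfolding ideal_direct_sum_def by (intro conjI U V)
qed

section \<open>A weakly prime ideal of product form\<close>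

text \<open>
  The condition \<open>I M \<subseteq> N\<close> is stated on the generators \<open>i m\<close>, which is equivalent because \<open>N\<close> is a
  subgroup. The witness \<open>(s, k)\<close> is part of the context, since all consequences hold for the same
  \<open>s\<close>, and weak primeness has the contrapositive form that is applied to concrete pairs.
\<close>

locale weakly_prime_Times = module R M for R (structure) and M (structure) +
  fixes I N s k
  assumes I: "ideal I R" and N: "submodule N R M"
    and I_smult_mem: "i \<in> I \<Longrightarrow> m \<in> carrier M \<Longrightarrow> i \<odot>\<^bsub>M\<^esub> m \<in> N"
    and s: "s \<in> carrier R" and k: "k \<in> N"
    and weak: "\<lbrakk>x \<in> carrier (idealization R M); y \<in> carrier (idealization R M);
      x \<otimes>\<^bsub>idealization R M\<^esub> y \<in> I \<times> N;
      (s, k) \<otimes>\<^bsub>idealization R M\<^esub> x \<notin> I \<times> N;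
      (s, k) \<otimes>\<^bsub>idealization R M\<^esub> y \<notin> I \<times> N\<rbrakk>
      \<Longrightarrow> x \<otimes>\<^bsub>idealization R M\<^esub> y = \<zero>\<^bsub>idealization R M\<^esub>"
begin

sublocale I: ideal I R by (rule I)

lemma N_carrier: "n \<in> N \<Longrightarrow> n \<in> carrier M"
  using submoduleE(1)[OF N] by auto

lemma N_zero: "\<zero>\<^bsub>M\<^esub> \<in> N"
  by (rule submodule_zero_mem[OF N])

lemma N_smult: "a \<in> carrier R \<Longrightarrow> n \<in> N \<Longrightarrow> a \<odot>\<^bsub>M\<^esub> n \<in> N"
  by (rule submoduleE(4)[OF N])

text \<open>
  The second coordinate of the product is \<open>s m + a k\<close>, and \<open>a k \<in> N\<close>.
\<close>

lemma witness_mult_mem_iff: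
  assumes "a \<in> carrier R" "m \<in> carrier M"
  shows "(s, k) \<otimes>\<^bsub>idealization R M\<^esub> (a, m) \<in> I \<times> N \<longleftrightarrow> s \<otimes> a \<in> I \<and> s \<odot>\<^bsub>M\<^esub> m \<in> N"
  using submodule_add_cancel[OF N N_smult[OF assms(1) k]] assms s by simp

lemma weak_coordinates:
  assumes "a \<in> carrier R" "m \<in> carrier M" "b \<in> carrier R" "n \<in> carrier M"
    and "a \<otimes> b \<in> I" "a \<odot>\<^bsub>M\<^esub> n \<oplus>\<^bsub>M\<^esub> b \<odot>\<^bsub>M\<^esub> m \<in> N"
    and "s \<otimes> a \<notin> I \<or> s \<odot>\<^bsub>M\<^esub> m \<notin> N"
    and "s \<otimes> b \<notin> I \<or> s \<odot>\<^bsub>M\<^esub> n \<notin> N"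
  shows "a \<otimes> b = \<zero>" and "a \<odot>\<^bsub>M\<^esub> n \<oplus>\<^bsub>M\<^esub> b \<odot>\<^bsub>M\<^esub> m = \<zero>\<^bsub>M\<^esub>"
proof -
  have "(a, m) \<otimes>\<^bsub>idealization R M\<^esub> (b, n) = \<zero>\<^bsub>idealization R M\<^esub>"
  proof (rule weak)
    show "(s, k) \<otimes>\<^bsub>idealization R M\<^esub> (a, m) \<notin> I \<times> N"
      unfolding witness_mult_mem_iff[OF assms(1,2)] using assms(7) by blast
    show "(s, k) \<otimes>\<^bsub>idealization R M\<^esub> (b, n) \<notin> I \<times> N"
      unfolding witness_mult_mem_iff[OF assms(3,4)] using assms(8) by blast
  qed (use assms(1-6) in auto)
  then show "a \<otimes> b = \<zero>" and "a \<odot>\<^bsub>M\<^esub> n \<oplus>\<^bsub>M\<^esub> b \<odot>\<^bsub>M\<^esub> m = \<zero>\<^bsub>M\<^esub>" by auto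
qed

subsection \<open>Weak primeness of the components\<close>

lemma ideal_weak:
  assumes "a \<in> carrier R" "b \<in> carrier R" "a \<otimes> b \<in> I" "a \<otimes> b \<noteq> \<zero>"
  shows "s \<otimes> a \<in> I \<or> s \<otimes> b \<in> I"
  using weak_coordinates(1)[of a "\<zero>\<^bsub>M\<^esub>" b "\<zero>\<^bsub>M\<^esub>"] assms N_zero s by force

lemma I_subset_colon: "I \<subseteq> colon R M N"
  using I_smult_mem I.a_Hcarr by (auto simp: colon_def)

lemma submodule_weak:
  assumes "a \<in> carrier R" "m \<in> carrier M" "a \<odot>\<^bsub>M\<^esub> m \<in> N" "a \<odot>\<^bsub>M\<^esub> m \<noteq> \<zero>\<^bsub>M\<^esub>"
  shows "s \<otimes> a \<in> I \<or> s \<odot>\<^bsub>M\<^esub> m \<in> N"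
  using weak_coordinates(2)[of a "\<zero>\<^bsub>M\<^esub>" \<zero> m] assms by auto

subsection \<open>Annihilation by the witnesses of non-primeness\<close>

lemma zero_divisor_annihilates_N:
  assumes a: "a \<in> carrier R" and b: "b \<in> carrier R" and ab: "a \<otimes> b = \<zero>"
    and sa: "s \<otimes> a \<notin> I" and sb: "s \<otimes> b \<notin> I"
  shows "b \<in> ann_module R M N"
proof -
  have "b \<odot>\<^bsub>M\<^esub> n = \<zero>\<^bsub>M\<^esub>" if n: "n \<in> N" for n
    \<comment> \<open>the pair \<open>(a, n), (b, 0)\<close>, whose product is \<open>(0, b n)\<close>\<close>
    using weak_coordinates(2)[of a n b "\<zero>\<^bsub>M\<^esub>"] N_smult[OF b n] N_carrier[OF n] a b ab sa sb
    by simp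
  then show ?thesis using b by (simp add: ann_module_def)
qed

lemma scalar_annihilates_I:
  assumes c: "c \<in> carrier R" and m: "m \<in> carrier M" and cm: "c \<odot>\<^bsub>M\<^esub> m = \<zero>\<^bsub>M\<^esub>"
    and sc: "s \<otimes> c \<notin> I" and sm: "s \<odot>\<^bsub>M\<^esub> m \<notin> N"
  shows "c \<in> ann_ideal R I"
proof -
  have "c \<otimes> i = \<zero>" if i: "i \<in> I" for i
    \<comment> \<open>the pair \<open>(c, 0), (i, m)\<close>, whose product is \<open>(c i, 0)\<close>\<close>
    using weak_coordinates(1)[of c "\<zero>\<^bsub>M\<^esub>" i m] I.I_l_closed[OF i c] I.a_Hcarr[OF i]
      c m cm sc sm N_zero by simp
  then show ?thesis using c by (simp add: ann_ideal_def)
qed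

lemma vector_annihilated_by_I:
  assumes c: "c \<in> carrier R" and m: "m \<in> carrier M" and cm: "c \<odot>\<^bsub>M\<^esub> m = \<zero>\<^bsub>M\<^esub>"
    and sc: "s \<otimes> c \<notin> I" and sm: "s \<odot>\<^bsub>M\<^esub> m \<notin> N"
  shows "m \<in> zero_colon M I"
proof -
  have "i \<odot>\<^bsub>M\<^esub> m = \<zero>\<^bsub>M\<^esub>" if i: "i \<in> I" for i
  proof -
    have ic: "i \<in> carrier R" by (rule I.a_Hcarr[OF i])
    have "s \<otimes> (c \<oplus> i) \<notin> I"
      using R.ideal_add_cancel[OF I I.I_l_closed[OF i s]] s c ic sc by (simp add: R.r_distr)
    moreover have "(c \<oplus> i) \<odot>\<^bsub>M\<^esub> m = i \<odot>\<^bsub>M\<^esub> m"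
      using c ic m cm by (simp add: smult_l_distr)
    \<comment> \<open>the pair \<open>(c + i, 0), (0, m)\<close>, whose product is \<open>(0, i m)\<close>\<close>
    ultimately show ?thesis
      using weak_coordinates(2)[of "c \<oplus> i" "\<zero>\<^bsub>M\<^esub>" \<zero> m] I_smult_mem[OF i m] c ic m sm by simp
  qed
  then show ?thesis using m by (simp add: zero_colon_def)
qed

subsection \<open>Splitting in the non-prime case\<close>

text \<open>
  The pair \<open>(0, m), (i, m)\<close> kills \<open>i m\<close> when \<open>s m \<notin> N\<close>: the second coordinate of the
  factor \<open>(i, m)\<close> is what keeps its multiple by the witness out of \<open>I \<times> N\<close>.
  When \<open>s m \<in> N\<close>, the factor \<open>s\<close> moves \<open>m\<close> into \<open>N\<close>, which \<open>I\<close> annihilates.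
\<close>

lemma s_I_annihilates_M:
  assumes IN: "\<And>i n. i \<in> I \<Longrightarrow> n \<in> N \<Longrightarrow> i \<odot>\<^bsub>M\<^esub> n = \<zero>\<^bsub>M\<^esub>"
    and i: "i \<in> I" and m: "m \<in> carrier M"
  shows "(s \<otimes> i) \<odot>\<^bsub>M\<^esub> m = \<zero>\<^bsub>M\<^esub>"
proof -
  have ic: "i \<in> carrier R" by (rule I.a_Hcarr[OF i])
  have kill: "i \<odot>\<^bsub>M\<^esub> v = \<zero>\<^bsub>M\<^esub>" if v: "v \<in> carrier M" "s \<odot>\<^bsub>M\<^esub> v \<notin> N" for v
    using weak_coordinates(2)[of \<zero> v i v] I_smult_mem[OF i v(1)] ic v by simp
  show ?thesis
  proof (cases "s \<odot>\<^bsub>M\<^esub> m \<in> N")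
    case True
    have "(s \<otimes> i) \<odot>\<^bsub>M\<^esub> m = i \<odot>\<^bsub>M\<^esub> (s \<odot>\<^bsub>M\<^esub> m)"
      using s ic m by (metis R.m_comm smult_assoc1)
    then show ?thesis using IN[OF i True] by simp
  next
    case False
    then show ?thesis using kill[OF m] s ic m by (simp add: smult_assoc1)
  qed
qed

text \<open>
  The mixed term \<open>i k\<close> of \<open>(s, k) (i, n)\<close> vanishes because \<open>k \<in> N\<close>, so the multiple of
  \<open>I \<times> N\<close> is the product \<open>s I \<times> s N\<close>, and \<open>(s I) M = 0\<close> lets it split along its axes.
\<close>

lemma witness_multiple_splits:
  assumes IN: "\<And>i n. i \<in> I \<Longrightarrow> n \<in> N \<Longrightarrow> i \<odot>\<^bsub>M\<^esub> n = \<zero>\<^bsub>M\<^esub>"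
  shows "ideal_direct_sum (idealization R M)
    ((s, k) <#\<^bsub>idealization R M\<^esub> (I \<times> N))
    (((\<lambda>i. s \<otimes> i) ` I) \<times> {\<zero>\<^bsub>M\<^esub>})
    ({\<zero>} \<times> (((\<lambda>n. s \<odot>\<^bsub>M\<^esub> n) ` N) <+>\<^bsub>M\<^esub> ((\<lambda>i. i \<odot>\<^bsub>M\<^esub> k) ` I)))"
proof -
  have "(\<lambda>i. i \<odot>\<^bsub>M\<^esub> k) ` I = (\<lambda>i. \<zero>\<^bsub>M\<^esub>) ` I"
    by (rule image_cong) (simp_all add: IN[OF _ k])
  also have "\<dots> = {\<zero>\<^bsub>M\<^esub>}"
    using ideal_zero_mem[OF I] by blast
  finally have sum: "((\<lambda>n. s \<odot>\<^bsub>M\<^esub> n) ` N) <+>\<^bsub>M\<^esub> ((\<lambda>i. i \<odot>\<^bsub>M\<^esub> k) ` I) = (\<lambda>n. s \<odot>\<^bsub>M\<^esub> n) ` N"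
    unfolding set_add_def' using s N_carrier by auto
  have mult: "(s, k) \<otimes>\<^bsub>idealization R M\<^esub> (i, n) = (s \<otimes> i, s \<odot>\<^bsub>M\<^esub> n)" if "i \<in> I" "n \<in> N" for i n
    using that IN[OF _ k] s N_carrier by simp
  have multiple: "(s, k) <#\<^bsub>idealization R M\<^esub> (I \<times> N)
      = ((\<lambda>i. s \<otimes> i) ` I) \<times> ((\<lambda>n. s \<odot>\<^bsub>M\<^esub> n) ` N)"
  proof (intro equalityI subrelI)
    fix j p assume "(j, p) \<in> (s, k) <#\<^bsub>idealization R M\<^esub> (I \<times> N)"
    then obtain i n where "i \<in> I" "n \<in> N"
      "(j, p) = (s, k) \<otimes>\<^bsub>idealization R M\<^esub> (i, n)"
      unfolding l_coset_def by blast
    then show "(j, p) \<in> ((\<lambda>i. s \<otimes> i) ` I) \<times> ((\<lambda>n. s \<odot>\<^bsub>M\<^esub> n) ` N)"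
      using mult by simp
  next
    fix j p assume "(j, p) \<in> ((\<lambda>i. s \<otimes> i) ` I) \<times> ((\<lambda>n. s \<odot>\<^bsub>M\<^esub> n) ` N)"
    then obtain i n where "i \<in> I" "n \<in> N" "j = s \<otimes> i" "p = s \<odot>\<^bsub>M\<^esub> n" by blast
    then show "(j, p) \<in> (s, k) <#\<^bsub>idealization R M\<^esub> (I \<times> N)"
      unfolding l_coset_def using mult[of i n] by force
  qed
  show ?thesis
    unfolding multiple sum
    by (rule ideal_direct_sum_Times[OF R.ideal_image_mult[OF I s] submodule_image_smult[OF N s]])
      (auto simp: s_I_annihilates_M[OF IN])
qed

text \<open>
  Here \<open>(0, i n) = (i, 0) (0, n)\<close> is a product of two elements of \<open>I \<times> N\<close>, an ideal of square zero.
\<close>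

lemma not_prime_smult_zero:
  assumes x: "x \<in> carrier (idealization R M)" and y: "y \<in> carrier (idealization R M)"
    and xy: "x \<otimes>\<^bsub>idealization R M\<^esub> y \<in> I \<times> N"
    and tx: "(s, k) \<otimes>\<^bsub>idealization R M\<^esub> x \<notin> I \<times> N"
    and ty: "(s, k) \<otimes>\<^bsub>idealization R M\<^esub> y \<notin> I \<times> N"
    and i: "i \<in> I" and n: "n \<in> N"
  shows "i \<odot>\<^bsub>M\<^esub> n = \<zero>\<^bsub>M\<^esub>"
proof -
  have "(i, \<zero>\<^bsub>M\<^esub>) \<otimes>\<^bsub>idealization R M\<^esub> (\<zero>, n) = \<zero>\<^bsub>idealization R M\<^esub>"
  proof (rule cring.weakly_prime_not_prime_square_zero[OF idealization_cring _ _ weak x y xy tx ty])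
    show "ideal (I \<times> N) (idealization R M)"
      using I N I_smult_mem by (rule ideal_Times_idealization)
  qed (use s k N_carrier i n N_zero ideal_zero_mem[OF I] in auto)
  then show ?thesis using I.a_Hcarr[OF i] N_carrier[OF n] by simp
qed

end

theorem theorem7:
  fixes R :: "('a, 'c) ring_scheme" and M :: "('a, 'm, 'd) module_scheme"
    and S I :: "'a set" and K N :: "'m set"
  assumes "module R M" and "\<one>\<^bsub>R\<^esub> \<noteq> \<zero>\<^bsub>R\<^esub>"
    and "mult_closed R S"
    and "ideal I R"
    and "submodule K R M" and "submodule N R M" and "K \<subseteq> N"
    and "ideal_smult I M \<subseteq> N"
    and "weakly_S_prime_ideal (S \<times> K) (I \<times> N) (idealization R M)"
  shows
   "(weakly_S_prime_ideal S I R \<and>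
      (colon R M N \<inter> S = {} \<longrightarrow> weakly_S_prime_submodule S N R M)) \<and>
    (\<exists>s\<in>S.
      (\<forall>a\<in>carrier R. \<forall>b\<in>carrier R.
        a \<otimes>\<^bsub>R\<^esub> b = \<zero>\<^bsub>R\<^esub> \<and> s \<otimes>\<^bsub>R\<^esub> a \<notin> I \<and> s \<otimes>\<^bsub>R\<^esub> b \<notin> I \<longrightarrow>
          a \<in> ann_module R M N \<and> b \<in> ann_module R M N) \<and>
      (\<forall>c\<in>carrier R. \<forall>m\<in>carrier M.
        c \<odot>\<^bsub>M\<^esub> m = \<zero>\<^bsub>M\<^esub> \<and> s \<otimes>\<^bsub>R\<^esub> c \<notin> colon R M N \<and> s \<odot>\<^bsub>M\<^esub> m \<notin> N \<longrightarrow>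
          c \<in> ann_ideal R I \<and> m \<in> zero_colon M I)) \<and>
    (\<not> S_prime_ideal (S \<times> K) (I \<times> N) (idealization R M) \<longrightarrow>
      (\<exists>s\<in>S. \<exists>k\<in>K.
        ideal_direct_sum (idealization R M)
          ((s, k) <#\<^bsub>idealization R M\<^esub> (I \<times> N))
          (((\<lambda>i. s \<otimes>\<^bsub>R\<^esub> i) ` I) \<times> {\<zero>\<^bsub>M\<^esub>})
          ({\<zero>\<^bsub>R\<^esub>} \<times> (((\<lambda>n. s \<odot>\<^bsub>M\<^esub> n) ` N) <+>\<^bsub>M\<^esub> ((\<lambda>i. i \<odot>\<^bsub>M\<^esub> k) ` I))))) \<and>
    (S_prime_ideal (S \<times> K) (I \<times> N) (idealization R M) \<longrightarrow>
      (\<exists>s\<in>S. (\<lambda>m. s \<odot>\<^bsub>M\<^esub> m) ` carrier M \<subseteq> N))"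
proof -
  let ?A = "idealization R M"
  let ?P = "I \<times> N"
  note wk = assms(9)[unfolded weakly_S_prime_ideal_def]
  from assms(3) have SR: "S \<subseteq> carrier R" by (simp add: mult_closed_def)
  interpret module R M by (rule assms(1))
  from wk obtain t where tSK: "t \<in> S \<times> K"
    and weak_t: "\<forall>x\<in>carrier ?A. \<forall>y\<in>carrier ?A.
      x \<otimes>\<^bsub>?A\<^esub> y \<noteq> \<zero>\<^bsub>?A\<^esub> \<and> x \<otimes>\<^bsub>?A\<^esub> y \<in> ?P \<longrightarrow> t \<otimes>\<^bsub>?A\<^esub> x \<in> ?P \<or> t \<otimes>\<^bsub>?A\<^esub> y \<in> ?P"
    by (elim conjE bexE)
  from tSK obtain s k where t: "t = (s, k)" and sS: "s \<in> S" and kK: "k \<in> K" by (rule SigmaE)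
  have weak: "(s, k) \<otimes>\<^bsub>?A\<^esub> x \<in> ?P \<or> (s, k) \<otimes>\<^bsub>?A\<^esub> y \<in> ?P"
    if "x \<in> carrier ?A" "y \<in> carrier ?A" "x \<otimes>\<^bsub>?A\<^esub> y \<noteq> \<zero>\<^bsub>?A\<^esub>" "x \<otimes>\<^bsub>?A\<^esub> y \<in> ?P" for x y
    using weak_t[unfolded t, rule_format, OF that(1,2)] that(3,4) by iprover
  have IM: "i \<odot>\<^bsub>M\<^esub> m \<in> N" if "i \<in> I" "m \<in> carrier M" for i m
  proof -
    have "i \<odot>\<^bsub>M\<^esub> m \<in> ideal_smult I M"
      unfolding ideal_smult_def using that by (intro generate.incl) auto
    then show ?thesis using assms(8) by auto
  qed
  interpret weakly_prime_Times R M I N s k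
  proof (intro weakly_prime_Times.intro weakly_prime_Times_axioms.intro assms(1,4,6))
    show "s \<in> carrier R" "k \<in> N" using assms(7) SR sS kK by auto
    show "x \<otimes>\<^bsub>?A\<^esub> y = \<zero>\<^bsub>?A\<^esub>"
      if "x \<in> carrier ?A" "y \<in> carrier ?A" "x \<otimes>\<^bsub>?A\<^esub> y \<in> ?P"
        "(s, k) \<otimes>\<^bsub>?A\<^esub> x \<notin> ?P" "(s, k) \<otimes>\<^bsub>?A\<^esub> y \<notin> ?P" for x y
      using weak[OF that(1,2) _ that(3)] that(4,5) by argo
  qed (rule IM)
  have colonI: "s \<otimes>\<^bsub>R\<^esub> c \<in> I \<Longrightarrow> s \<otimes>\<^bsub>R\<^esub> c \<in> colon R M N" for c
    using I_subset_colon by auto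
  have "I \<inter> S = {}" using wk kK assms(7) by auto
  then have "weakly_S_prime_ideal S I R"
    unfolding weakly_S_prime_ideal_def using assms(4) sS ideal_weak by blast
  moreover have "weakly_S_prime_submodule S N R M" if "colon R M N \<inter> S = {}"
    unfolding weakly_S_prime_submodule_def
    using that assms(6) sS submodule_weak colonI by blast
  moreover have "\<exists>s\<in>S.
      (\<forall>a\<in>carrier R. \<forall>b\<in>carrier R.
        a \<otimes>\<^bsub>R\<^esub> b = \<zero>\<^bsub>R\<^esub> \<and> s \<otimes>\<^bsub>R\<^esub> a \<notin> I \<and> s \<otimes>\<^bsub>R\<^esub> b \<notin> I \<longrightarrow>
          a \<in> ann_module R M N \<and> b \<in> ann_module R M N) \<and>
      (\<forall>c\<in>carrier R. \<forall>m\<in>carrier M.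
        c \<odot>\<^bsub>M\<^esub> m = \<zero>\<^bsub>M\<^esub> \<and> s \<otimes>\<^bsub>R\<^esub> c \<notin> colon R M N \<and> s \<odot>\<^bsub>M\<^esub> m \<notin> N \<longrightarrow>
          c \<in> ann_ideal R I \<and> m \<in> zero_colon M I)"
  proof (rule bexI[OF _ sS], intro conjI ballI impI; elim conjE)
    fix a b
    assume ab: "a \<in> carrier R" "b \<in> carrier R" "a \<otimes>\<^bsub>R\<^esub> b = \<zero>\<^bsub>R\<^esub>" "s \<otimes>\<^bsub>R\<^esub> a \<notin> I" "s \<otimes>\<^bsub>R\<^esub> b \<notin> I"
    show "b \<in> ann_module R M N" using ab by (rule zero_divisor_annihilates_N)
    have "b \<otimes>\<^bsub>R\<^esub> a = \<zero>\<^bsub>R\<^esub>" using ab R.m_comm by simp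
    then show "a \<in> ann_module R M N" using ab zero_divisor_annihilates_N by blast
  next
    fix c m
    assume cm: "c \<in> carrier R" "m \<in> carrier M" "c \<odot>\<^bsub>M\<^esub> m = \<zero>\<^bsub>M\<^esub>"
      and "s \<otimes>\<^bsub>R\<^esub> c \<notin> colon R M N" and sm: "s \<odot>\<^bsub>M\<^esub> m \<notin> N"
    then have sc: "s \<otimes>\<^bsub>R\<^esub> c \<notin> I" using colonI by blast
    show "c \<in> ann_ideal R I" using cm sc sm by (rule scalar_annihilates_I)
    show "m \<in> zero_colon M I" using cm sc sm by (rule vector_annihilated_by_I)
  qed
  moreover have "\<exists>s\<in>S. \<exists>k\<in>K.
        ideal_direct_sum ?A
          ((s, k) <#\<^bsub>?A\<^esub> ?P)
          (((\<lambda>i. s \<otimes>\<^bsub>R\<^esub> i) ` I) \<times> {\<zero>\<^bsub>M\<^esub>})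
          ({\<zero>\<^bsub>R\<^esub>} \<times> (((\<lambda>n. s \<odot>\<^bsub>M\<^esub> n) ` N) <+>\<^bsub>M\<^esub> ((\<lambda>i. i \<odot>\<^bsub>M\<^esub> k) ` I)))"
    if np: "\<not> S_prime_ideal (S \<times> K) ?P ?A"
  proof -
    \<comment> \<open>non-primeness defeats every candidate, in particular the weak witness \<open>(s, k)\<close>\<close>
    have "(s, k) \<in> S \<times> K" using sS kK by simp
    then obtain x y where "x \<in> carrier ?A" "y \<in> carrier ?A" "x \<otimes>\<^bsub>?A\<^esub> y \<in> ?P"
      "(s, k) \<otimes>\<^bsub>?A\<^esub> x \<notin> ?P" "(s, k) \<otimes>\<^bsub>?A\<^esub> y \<notin> ?P"
      using np wk unfolding S_prime_ideal_def by meson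
    then have "i \<odot>\<^bsub>M\<^esub> n = \<zero>\<^bsub>M\<^esub>" if "i \<in> I" "n \<in> N" for i n
      using that by (rule not_prime_smult_zero)
    then show ?thesis using witness_multiple_splits sS kK by blast
  qed
  moreover have "\<exists>s\<in>S. (\<lambda>m. s \<odot>\<^bsub>M\<^esub> m) ` carrier M \<subseteq> N"
    if "S_prime_ideal (S \<times> K) ?P ?A"
  proof -
    from that obtain t' where t'SK: "t' \<in> S \<times> K"
      and prime: "\<forall>x\<in>carrier ?A. \<forall>y\<in>carrier ?A.
        x \<otimes>\<^bsub>?A\<^esub> y \<in> ?P \<longrightarrow> t' \<otimes>\<^bsub>?A\<^esub> x \<in> ?P \<or> t' \<otimes>\<^bsub>?A\<^esub> y \<in> ?P"
      unfolding S_prime_ideal_def by (elim conjE bexE)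
    from t'SK obtain s' k' where t': "t' = (s', k')" and s': "s' \<in> S" and k': "k' \<in> K"
      by (rule SigmaE)
    have s'R: "s' \<in> carrier R" and k'M: "k' \<in> carrier M"
      using s' SR k' assms(7) N_carrier by auto
    have "s' \<odot>\<^bsub>M\<^esub> m \<in> N" if m: "m \<in> carrier M" for m
      using prime[unfolded t', rule_format, of "(\<zero>\<^bsub>R\<^esub>, m)" "(\<zero>\<^bsub>R\<^esub>, m)"] m s'R k'M N_zero by simp
    then show ?thesis using s' by auto
  qed
  ultimately show ?thesis by blast
qed

end
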